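(* Let $p\in[1,\infty)$ and $q\in(1,\infty]$. Every function $f\in W^{1,p,q}(0,\infty)$ tends to zero at infinity, i.e. $\lim_{t\to\infty}f(t)=0$.
   Context: $W^{1,p,q}(0,\infty)=\{f \mid f\in L^p(0,\infty)\text{ and } f'\in L^q(0,\infty)\}$ denotes the "mixed Sobolev space" of real-valued functions. Here $f'$ is understood in the sense of distributions or, equivalently, in the sense that $f$ (after identification with its continuous representative) is locally absolutely continuous and $f'$ is its almost everywhere existing derivative. Each $f\in W^{1,p,q}(0,\infty)$ is identified with its continuous representative. *)

theory Defs
  imports "HOL-Analysis.Analysis"
begin

text \<open>
  \<open>Lp_fun M p f\<close> states that the function \<open>f\<close> (not its equivalence class) belongs to the Lebesgue
  space \<open>L\<^sup>p\<close> of the measure space \<open>M\<close>. It is meant for exponents \<open>1 \<le> p \<le> \<infinity>\<close>; for \<open>p = \<infinity>\<close>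
  it is essential boundedness.
\<close>

definition Lp_fun :: "'a measure \<Rightarrow> ennreal \<Rightarrow> ('a \<Rightarrow> real) \<Rightarrow> bool" where
  "Lp_fun M p f \<longleftrightarrow> f \<in> borel_measurable M \<and>
     (if p = \<infinity> then \<exists>C. AE x in M. \<bar>f x\<bar> \<le> C
      else integrable M (\<lambda>x. \<bar>f x\<bar> powr enn2real p))"

text \<open>
  A finite family of non-overlapping compact intervals \<open>[u, v]\<close> contained in \<open>S\<close> is a \<open>d\<close> with
  \<open>d division_of \<Union>d\<close> and \<open>\<Union>d \<subseteq> S\<close>; for \<open>k = [u, v]\<close> one has \<open>u = Inf k\<close> and \<open>v = Sup k\<close>.
\<close>

definition abs_continuous_on :: "real set \<Rightarrow> (real \<Rightarrow> real) \<Rightarrow> bool" where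
  "abs_continuous_on S f \<longleftrightarrow>
     (\<forall>\<epsilon>>0. \<exists>\<delta>>0. \<forall>d. d division_of \<Union>d \<longrightarrow> \<Union>d \<subseteq> S \<longrightarrow>
        (\<Sum>k\<in>d. Sup k - Inf k) < \<delta> \<longrightarrow> (\<Sum>k\<in>d. \<bar>f (Sup k) - f (Inf k)\<bar>) < \<epsilon>)"

definition locally_abs_continuous_on :: "real set \<Rightarrow> (real \<Rightarrow> real) \<Rightarrow> bool" where
  "locally_abs_continuous_on S f \<longleftrightarrow> (\<forall>a b. {a..b} \<subseteq> S \<longrightarrow> abs_continuous_on {a..b} f)"

text \<open>
  The elements of \<open>W\<^sup>1\<^sup>,\<^sup>p\<^sup>,\<^sup>q(0,\<infinity>)\<close> are represented by their continuous representatives, as functions on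
  \<open>\<real>\<close> of which only the values on \<open>(0,\<infinity>)\<close> matter. The function \<open>g\<close> is the almost everywhere
  existing derivative \<open>f'\<close>.
\<close>

definition mixed_Sobolev :: "ennreal \<Rightarrow> ennreal \<Rightarrow> (real \<Rightarrow> real) set" where
  "mixed_Sobolev p q =
     {f. Lp_fun (lebesgue_on {0<..}) p f \<and> locally_abs_continuous_on {0<..} f \<and>
         (\<exists>g. (AE x in lebesgue_on {0<..}. (f has_real_derivative g x) (at x)) \<and>
              Lp_fun (lebesgue_on {0<..}) q g)}"

end

theory Submission
  imports Defs
begin

text \<open>
  Since \<open>\<bar>f'\<bar> \<le> 1 + \<bar>f'\<bar>\<^sup>q\<close> for finite \<open>q\<close>, in all cases \<open>\<bar>f'\<bar> \<le> C + h\<close> with \<open>h \<ge> 0\<close> integrable. Hence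
  \<open>\<bar>f y - f x\<bar> \<le> C (y - x) + \<integral>\<^sub>x\<^sup>y h\<close>, so \<open>f\<close> hardly changes on short intervals far out. If \<open>\<bar>f x\<bar> \<ge> \<epsilon>\<close>
  at some \<open>x\<close> far out, then \<open>\<bar>f\<bar> \<ge> \<epsilon> / 2\<close> on an interval of fixed length \<open>\<delta>\<close> starting at \<open>x\<close>, which
  contradicts the smallness of the tail of \<open>\<integral> \<bar>f\<bar>\<^sup>p\<close>.
\<close>

section \<open>The fundamental theorem of calculus for absolutely continuous functions\<close>

hide_const (open) Polynomial.content

text \<open>Distinct intervals of the division meet only in negligible sets, so their contents add
  up to the measure of their union. This converts a cover of small measure into a bound on total
  length.\<close>

lemma sum_content_tagged_partial_division_le:
  fixes U :: "'a::euclidean_space set"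
  assumes p: "p tagged_partial_division_of S"
    and U: "U \<in> lmeasurable" "\<And>x K. (x, K) \<in> p \<Longrightarrow> K \<subseteq> U"
  shows "(\<Sum>(x, K)\<in>p. content K) \<le> measure lebesgue U"
proof -
  let ?D = "snd ` p"
  note div = partial_division_of_tagged_division[OF p]
  have cbox: "\<exists>a b. K = cbox a b" if "K \<in> ?D" for K
    using division_ofD(4)[OF div that] by blast
  have "(\<Sum>(x, K)\<in>p. content K) = sum content ?D"
    \<comment> \<open>Two tags can share an interval only if its interior is empty; since its
      content is then 0, dropping the tags loses nothing.\<close>
    by (rule sum.over_tagged_division_lemma[OF tagged_partial_division_of_Union_self[OF p]])
      (simp add: content_eq_0_interior interior_cbox)
  also have "\<dots> = (\<Sum>K\<in>?D. measure lebesgue K)"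
    using cbox by (intro sum.cong refl) (fastforce simp: measure_completion)
  also have "\<dots> = measure lebesgue (\<Union>?D)"
  proof (rule measure_negligible_finite_Union[symmetric])
    show "finite ?D"
      using division_ofD(1)[OF div] .
    show "K \<in> lmeasurable" if "K \<in> ?D" for K
      using cbox[OF that] by auto
    show "pairwise (\<lambda>K L. negligible (K \<inter> L)) ?D"
    proof (rule pairwiseI)
      fix K L assume KL: "K \<in> ?D" "L \<in> ?D" "K \<noteq> L"
      obtain a b c d where eq: "K = cbox a b" "L = cbox c d"
        using cbox KL by meson
      have "interior (K \<inter> L) = {}"
        using division_ofD(5)[OF div KL] by simp
      then show "negligible (K \<inter> L)"
        unfolding eq Int_interval by (simp add: negligible_interval interior_cbox)
    qed
  qed
  also have "\<dots> \<le> measure lebesgue U"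
  proof (rule measure_mono_fmeasurable)
    show "\<Union>?D \<subseteq> U"
      using U(2) by force
    show "\<Union>?D \<in> sets lebesgue"
      using cbox division_ofD(1)[OF div] by (intro sets.finite_Union) force+
  qed (rule U(1))
  finally show ?thesis .
qed

text \<open>Gauge integrals sum over tagged intervals, while \<open>abs_continuous_on\<close> sums
  over a set of intervals. The two sums agree because an interval with several tags is a single
  point, over which \<open>f\<close> has no increment.\<close>

lemma abs_continuous_on_tagged_partial_division:
  assumes ac: "abs_continuous_on S f" and "e > 0"
  obtains \<delta> where "\<delta> > 0"
    "\<And>p. p tagged_partial_division_of S \<Longrightarrow> (\<Sum>(x, K)\<in>p. content K) < \<delta> \<Longrightarrow>
      (\<Sum>(x, K)\<in>p. \<bar>f (Sup K) - f (Inf K)\<bar>) < e"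
proof -
  obtain \<delta> where "\<delta> > 0" and \<delta>: "\<And>d. d division_of \<Union>d \<Longrightarrow> \<Union>d \<subseteq> S \<Longrightarrow>
      (\<Sum>k\<in>d. Sup k - Inf k) < \<delta> \<Longrightarrow> (\<Sum>k\<in>d. \<bar>f (Sup k) - f (Inf k)\<bar>) < e"
    using ac \<open>e > 0\<close> unfolding abs_continuous_on_def by meson
  have "(\<Sum>(x, K)\<in>p. \<bar>f (Sup K) - f (Inf K)\<bar>) < e"
    if p: "p tagged_partial_division_of S" and less: "(\<Sum>(x, K)\<in>p. content K) < \<delta>" for p
  proof -
    let ?D = "snd ` p"
    note div = partial_division_of_tagged_division[OF p]
    note self = tagged_partial_division_of_Union_self[OF p]
    have ne: "K \<noteq> {}" if "K \<in> ?D" for K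
      using division_ofD(3)[OF div that] .
    have "Sup K - Inf K = content K" if "K \<in> ?D" for K
    proof -
      obtain u v where "K = cbox u v"
        using division_ofD(4)[OF div \<open>K \<in> ?D\<close>] by blast
      with ne[OF that] show ?thesis
        by simp
    qed
    then have "(\<Sum>K\<in>?D. Sup K - Inf K) = sum content ?D"
      by (intro sum.cong refl)
    also have "\<dots> = (\<Sum>(x, K)\<in>p. content K)"
      by (rule sum.over_tagged_division_lemma[OF self, symmetric])
        (simp add: content_eq_0_interior interior_cbox)
    finally have "(\<Sum>K\<in>?D. Sup K - Inf K) < \<delta>"
      using less by simp
    moreover have "\<Union>?D \<subseteq> S"
      using tagged_partial_division_ofD(3)[OF p] by fastforce
    ultimately have "(\<Sum>K\<in>?D. \<bar>f (Sup K) - f (Inf K)\<bar>) < e"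
      using \<delta> div by blast
    \<comment> \<open>The summand must vanish on every \<open>cbox u v\<close> with empty interior,
      including the empty one, where \<open>Sup\<close> and \<open>Inf\<close> have no useful value.
      The case distinction supplies 0 there.\<close>
    also have "(\<Sum>K\<in>?D. \<bar>f (Sup K) - f (Inf K)\<bar>)
        = (\<Sum>K\<in>?D. if K = {} then 0 else \<bar>f (Sup K) - f (Inf K)\<bar>)"
      using ne by (intro sum.cong) auto
    also have "\<dots> = (\<Sum>(x, K)\<in>p. if K = {} then 0 else \<bar>f (Sup K) - f (Inf K)\<bar>)"
      by (rule sum.over_tagged_division_lemma[OF self, symmetric]) force
    also have "\<dots> = (\<Sum>(x, K)\<in>p. \<bar>f (Sup K) - f (Inf K)\<bar>)"
      using ne by (intro sum.cong) force+
    finally show ?thesis .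
  qed
  with \<open>\<delta> > 0\<close> show thesis
    by (rule that)
qed

text \<open>
  Away from the exceptional set \<open>N\<close> the gauge is the usual one of the straddle lemma. At the tags
  in \<open>N\<close> it forces the intervals into an open set of small measure, where absolute continuity
  bounds the increments of \<open>f\<close>.
\<close>

theorem fundamental_theorem_of_calculus_abs_continuous:
  fixes f :: "real \<Rightarrow> real"
  assumes ab: "a \<le> b" and ac: "abs_continuous_on {a..b} f" and N: "negligible N"
    and deriv: "\<And>x. x \<in> {a..b} - N \<Longrightarrow> (f has_real_derivative g x) (at x within {a..b})"
  shows "(g has_integral (f b - f a)) {a..b}"
proof -
  \<comment> \<open>With value 0 on \<open>N\<close>, the tags in \<open>N\<close> add nothing to a
    Riemann sum; only the increments of \<open>f\<close> over their intervals have to be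
    estimated.\<close>
  define g0 where "g0 = (\<lambda>x. if x \<in> N then 0 else g x)"
  have "(g0 has_integral (f b - f a)) {a..b}"
    unfolding has_integral_real
  proof (intro allI impI)
    fix e :: real assume "e > 0"
    obtain \<delta> where "\<delta> > 0" and \<delta>: "\<And>p. p tagged_partial_division_of {a..b} \<Longrightarrow>
        (\<Sum>(x, K)\<in>p. content K) < \<delta> \<Longrightarrow> (\<Sum>(x, K)\<in>p. \<bar>f (Sup K) - f (Inf K)\<bar>) < e / 2"
      using abs_continuous_on_tagged_partial_division[OF ac half_gt_zero[OF \<open>e > 0\<close>]] by blast
    obtain U where U: "open U" "N \<subseteq> U" "U \<in> lmeasurable" "measure lebesgue U < \<delta>"
    proof -
      have NL: "N \<in> lmeasurable" "measure lebesgue N = 0"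
        using N negligible_iff_measure by auto
      obtain U where "open U" "N \<subseteq> U" "U - N \<in> lmeasurable"
          "emeasure lebesgue (U - N) < ennreal \<delta>"
        using sets_lebesgue_outer_open[of N \<delta>] NL \<open>\<delta> > 0\<close> by blast
      moreover have "U = (U - N) \<union> N"
        using \<open>N \<subseteq> U\<close> by blast
      ultimately have "U \<in> lmeasurable"
        using NL(1) fmeasurable.Un by metis
      moreover have "measure lebesgue U = measure lebesgue (U - N)"
        using measure_Diff_null_set[of U lebesgue N] N \<open>U \<in> lmeasurable\<close>
        by (simp add: fmeasurableD negligible_iff_null_sets)
      moreover have "measure lebesgue (U - N) < \<delta>"
        using \<open>emeasure lebesgue (U - N) < ennreal \<delta>\<close> \<open>U - N \<in> lmeasurable\<close> \<open>\<delta> > 0\<close>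
        by (simp add: emeasure_eq_measure2 ennreal_less_iff)
      ultimately show thesis
        using that \<open>open U\<close> \<open>N \<subseteq> U\<close> by simp
    qed
    \<comment> \<open>The summand 1 keeps the denominator positive for \<open>a = b\<close> and
      makes the next bound strict.\<close>
    define e' where "e' = e / (2 * (b - a + 1))"
    have "e' > 0" and e': "e' * (b - a) < e / 2"
      using ab \<open>e > 0\<close> by (auto simp: e'_def field_simps)
    \<comment> \<open>The condition on \<open>x\<close> stands inside the existential so that a
      positive radius is chosen at every point, as a gauge requires.\<close>
    have "\<exists>d>0. x \<in> {a..b} - N \<longrightarrow>
        (\<forall>y\<in>{a..b}. \<bar>y - x\<bar> < d \<longrightarrow> \<bar>f y - f x - g x * (y - x)\<bar> \<le> e' * \<bar>y - x\<bar>)" for x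
    proof (cases "x \<in> {a..b} - N")
      case True
      then show ?thesis
        using deriv \<open>e' > 0\<close> unfolding has_field_derivative_def has_derivative_within_alt by fastforce
    qed (use zero_less_one in blast)
    then obtain d where d0: "\<And>x. 0 < d x"
      and d: "\<And>x y. x \<in> {a..b} - N \<Longrightarrow> y \<in> {a..b} \<Longrightarrow> \<bar>y - x\<bar> < d x \<Longrightarrow>
        \<bar>f y - f x - g x * (y - x)\<bar> \<le> e' * \<bar>y - x\<bar>"
      by metis
    define \<gamma> where "\<gamma> = (\<lambda>x. if x \<in> N then U else ball x (d x))"
    have gauge: "gauge \<gamma>"
      using U d0 by (auto simp: gauge_def \<gamma>_def)
    have sums: "norm ((\<Sum>(x, K)\<in>p. content K *\<^sub>R g0 x) - (f b - f a)) < e"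
      if p: "p tagged_division_of {a..b}" and fine: "\<gamma> fine p" for p
    proof -
      \<comment> \<open>\<open>P\<close> collects the pairs tagged in \<open>N\<close>, and
        \<open>F\<close> is the error of one term. The increments telescope to
        \<open>f b - f a\<close>, so the total error is \<open>sum F p\<close>, with at most half of
        \<open>e\<close> allotted to each of \<open>P\<close> and \<open>p - P\<close>.\<close>
      define P where "P = {(x, K) \<in> p. x \<in> N}"
      define F where "F = (\<lambda>(x, K). content K * g0 x - (f (Sup K) - f (Inf K)))"
      have fin: "finite p" and "P \<subseteq> p"
        using p by (auto simp: P_def)
      have ptag: "p tagged_partial_division_of {a..b}"
        using p by (simp add: tagged_division_of_def)
      have Ptag: "P tagged_partial_division_of {a..b}"
        using tagged_partial_division_subset[OF ptag \<open>P \<subseteq> p\<close>] .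
      have "\<bar>sum F P\<bar> \<le> (\<Sum>(x, K)\<in>P. \<bar>f (Sup K) - f (Inf K)\<bar>)"
        by (rule order_trans[OF sum_abs]) (auto simp: F_def P_def g0_def intro!: sum_mono)
      also have "\<dots> < e / 2"
      proof (rule \<delta>[OF Ptag])
        have "K \<subseteq> U" if "(x, K) \<in> P" for x K
          using that fine by (force simp: P_def \<gamma>_def fine_def)
        then show "(\<Sum>(x, K)\<in>P. content K) < \<delta>"
          using sum_content_tagged_partial_division_le[OF Ptag U(3)] U(4) by fastforce
      qed
      finally have bad: "\<bar>sum F P\<bar> < e / 2" .
      have good_K: "\<bar>F (x, K)\<bar> \<le> e' * content K" if "(x, K) \<in> p - P" for x K
      proof -
        have xK: "x \<in> K" "K \<subseteq> {a..b}" "(x, K) \<in> p" "x \<notin> N"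
          using that p by (auto simp: P_def)
        then obtain u v where K: "K = {u..v}"
          using p by (metis box_real(2) tagged_division_ofD(4))
        have uv: "u \<le> x" "x \<le> v"
          using xK K by auto
        then have uvK: "u \<in> K" "v \<in> K" and ab_uvx: "u \<in> {a..b}" "v \<in> {a..b}" "x \<in> {a..b}"
          using K xK by auto
        have "K \<subseteq> ball x (d x)"
          using fine xK by (force simp: \<gamma>_def fine_def)
        then have "\<bar>u - x\<bar> < d x" "\<bar>v - x\<bar> < d x"
          using uvK by (auto simp: dist_real_def)
        then have "\<bar>f u - f x - g x * (u - x)\<bar> \<le> e' * (x - u)"
            "\<bar>f v - f x - g x * (v - x)\<bar> \<le> e' * (v - x)"
          using d[of x u] d[of x v] xK(4) ab_uvx uv by auto
        \<comment> \<open>The tag lies between \<open>u\<close> and \<open>v\<close>, so the two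
          one-sided errors, proportional to \<open>x - u\<close> and \<open>v - x\<close>, add up to
          a multiple of the length of \<open>K\<close>.\<close>
        moreover have "F (x, K) = (f u - f x - g x * (u - x)) - (f v - f x - g x * (v - x))"
          using uv xK by (simp add: F_def K g0_def algebra_simps)
        moreover have "e' * content K = e' * (x - u) + e' * (v - x)"
          using uv by (simp add: K algebra_simps)
        ultimately show ?thesis
          by linarith
      qed
      have "\<bar>sum F (p - P)\<bar> \<le> (\<Sum>(x, K)\<in>p - P. e' * content K)"
        by (rule order_trans[OF sum_abs sum_mono]) (use good_K in auto)
      also have "\<dots> \<le> (\<Sum>(x, K)\<in>p. e' * content K)"
        using fin \<open>e' > 0\<close> by (intro sum_mono2) auto
      also have "\<dots> = e' * (\<Sum>(x, K)\<in>p. content K)"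
        by (simp add: sum_distrib_left split_def)
      also have "\<dots> = e' * (b - a)"
        using additive_content_tagged_division[of p a b] p ab by simp
      finally have good: "\<bar>sum F (p - P)\<bar> < e / 2"
        using e' by simp
      have "(\<Sum>(x, K)\<in>p. content K *\<^sub>R g0 x) - (f b - f a) = sum F p"
        by (simp add: F_def additive_tagged_division_1[OF ab p, symmetric] split_def sum_subtractf)
      also have "\<dots> = sum F (p - P) + sum F P"
        using sum.subset_diff[OF \<open>P \<subseteq> p\<close> fin] .
      finally show ?thesis
        using good bad by simp
    qed
    show "\<exists>\<gamma>. gauge \<gamma> \<and> (\<forall>p. p tagged_division_of {a..b} \<and> \<gamma> fine p \<longrightarrow>
        norm ((\<Sum>(x, K)\<in>p. content K *\<^sub>R g0 x) - (f b - f a)) < e)"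
      by (intro exI[of _ \<gamma>] conjI allI impI gauge sums) auto
  qed
  then show ?thesis
    by (rule has_integral_spike[OF N, rotated]) (simp add: g0_def)
qed

section \<open>Tails of integrals and decay at infinity\<close>

text \<open>The integrals from a fixed base point are bounded by the integral over the half-line.
  Once one of them is within \<open>e\<close> of their supremum, less than \<open>e\<close> remains
  for any later interval.\<close>

lemma integral_interval_tail_less:
  fixes h :: "real \<Rightarrow> real"
  assumes h: "h integrable_on {c<..}" and nonneg: "\<And>x. x > c \<Longrightarrow> 0 \<le> h x" and "e > 0"
  obtains T where "T > c" "\<And>x y. T \<le> x \<Longrightarrow> integral {x..y} h < e"
proof -
  have int: "h integrable_on {x..y}" if "c < x" for x y
    using that by (intro integrable_on_subinterval[OF h]) auto
  \<comment> \<open>The base point \<open>c + 1\<close> keeps all compact intervals inside the open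
    half-line.\<close>
  define F where "F = (\<lambda>t. integral {c + 1..t} h)"
  have "F t \<le> integral {c<..} h" for t
    unfolding F_def using h nonneg int by (intro integral_subset_le) auto
  then have bdd: "bdd_above (F ` {c + 1..})"
    by (intro bdd_aboveI) auto
  obtain T where T: "T \<ge> c + 1" "F T > (SUP t\<in>{c + 1..}. F t) - e"
    using less_cSUP_iff[OF _ bdd, of "(SUP t\<in>{c + 1..}. F t) - e"] \<open>e > 0\<close> by force
  have "integral {x..y} h < e" if "T \<le> x" for x y
  proof (cases "x \<le> y")
    case True
    have "F T + integral {T..y} h = F y"
      unfolding F_def using T that True int by (intro Henstock_Kurzweil_Integration.integral_combine) auto
    moreover have "F y \<le> (SUP t\<in>{c + 1..}. F t)"
      using bdd T that True by (intro cSUP_upper) auto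
    moreover have "integral {x..y} h \<le> integral {T..y} h"
      using T that int nonneg by (intro integral_subset_le) auto
    ultimately show ?thesis
      using T by linarith
  next
    case False
    then show ?thesis
      using \<open>e > 0\<close> by simp
  qed
  with T show thesis
    by (intro that[of T]) auto
qed

lemma increments_small_at_top:
  fixes f g h :: "real \<Rightarrow> real"
  assumes fg: "\<And>x y. c < x \<Longrightarrow> x \<le> y \<Longrightarrow> (g has_integral (f y - f x)) {x..y}"
    and N: "negligible N" and bound: "\<And>x. c < x \<Longrightarrow> x \<notin> N \<Longrightarrow> \<bar>g x\<bar> \<le> C + h x"
    and h: "h integrable_on {c<..}" "\<And>x. c < x \<Longrightarrow> 0 \<le> h x" and C: "0 \<le> C" and "e > 0"
  obtains T \<delta> where "T > c" "\<delta> > 0"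
    "\<And>x y. T \<le> x \<Longrightarrow> x \<le> y \<Longrightarrow> y \<le> x + \<delta> \<Longrightarrow> \<bar>f y - f x\<bar> < e"
proof -
  obtain T where T: "T > c" "\<And>x y. T \<le> x \<Longrightarrow> integral {x..y} h < e / 2"
    using integral_interval_tail_less[OF h, of "e / 2"] \<open>e > 0\<close> by auto
  \<comment> \<open>The constant part of the bound contributes at most \<open>C * \<delta>\<close>,
    hence at most \<open>e / 2\<close>; \<open>C + 1\<close> avoids a zero denominator. As
    \<open>\<delta>\<close> depends only on \<open>C\<close> and \<open>e\<close>, the estimate is
    uniform in \<open>x\<close>.\<close>
  define \<delta> where "\<delta> = e / (2 * (C + 1))"
  have "\<delta> > 0" and \<delta>: "C * \<delta> \<le> e / 2"
    using C \<open>e > 0\<close> by (auto simp: \<delta>_def field_simps)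
  have "\<bar>f y - f x\<bar> < e" if xy: "T \<le> x" "x \<le> y" "y \<le> x + \<delta>" for x y
  proof -
    \<comment> \<open>The norm estimate wants a bound at every point, so \<open>g\<close> is set to
      0 on \<open>N\<close>, where \<open>0 \<le> C + h t\<close> suffices.\<close>
    define g0 where "g0 = (\<lambda>x. if x \<in> N then 0 else g x)"
    have "(g has_integral (f y - f x)) {x..y}"
      using fg xy T by auto
    then have g0: "(g0 has_integral (f y - f x)) {x..y}"
      by (rule has_integral_spike[OF N, rotated]) (simp add: g0_def)
    have hint: "h integrable_on {x..y}"
      using xy T by (intro integrable_on_subinterval[OF h(1)]) auto
    have "norm (integral {x..y} g0) \<le> integral {x..y} (\<lambda>t. C + h t)"
    proof (rule Henstock_Kurzweil_Integration.integral_norm_bound_integral)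
      show "norm (g0 t) \<le> C + h t" if "t \<in> {x..y}" for t
        using bound[of t] h(2)[of t] C that xy T by (auto simp: g0_def)
    qed (use g0 hint in \<open>auto intro!: integrable_add\<close>)
    also have "\<dots> = C * (y - x) + integral {x..y} h"
      using hint xy by (subst Henstock_Kurzweil_Integration.integral_add) auto
    also have "\<dots> < e"
      using mult_left_mono[of "y - x" \<delta> C] C xy \<delta> T(2)[of x y] by linarith
    finally show ?thesis
      using g0 by (simp add: integral_unique)
  qed
  with T(1) \<open>\<delta> > 0\<close> show thesis
    by (rule that)
qed

text \<open>A form of Barbalat's lemma; the condition on increments is an asymptotic version of
  uniform continuity.\<close>

lemma tendsto_0_at_top_if_increments_small:
  fixes f :: "real \<Rightarrow> real"
  assumes incr: "\<And>e. e > 0 \<Longrightarrow> \<exists>T \<delta>. \<delta> > 0 \<and>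
      (\<forall>x y. T \<le> x \<longrightarrow> x \<le> y \<longrightarrow> y \<le> x + \<delta> \<longrightarrow> \<bar>f y - f x\<bar> < e)"
    and int: "(\<lambda>x. \<bar>f x\<bar> powr r) integrable_on {c<..}" and "0 \<le> r"
  shows "(f \<longlongrightarrow> 0) at_top"
proof (rule tendstoI)
  fix e :: real assume "e > 0"
  then obtain T \<delta> where "\<delta> > 0"
    and T: "\<And>x y. T \<le> x \<Longrightarrow> x \<le> y \<Longrightarrow> y \<le> x + \<delta> \<Longrightarrow> \<bar>f y - f x\<bar> < e / 2"
    using incr[of "e / 2"] by (metis half_gt_zero)
  \<comment> \<open>The threshold is the integral of the constant \<open>(e / 2) powr r\<close> over
    an interval of length \<open>\<delta>\<close>.\<close>
  obtain S where S: "S > c" "\<And>x y. S \<le> x \<Longrightarrow> integral {x..y} (\<lambda>x. \<bar>f x\<bar> powr r) < \<delta> * (e / 2) powr r"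
    using integral_interval_tail_less[OF int, of "\<delta> * (e / 2) powr r"] \<open>\<delta> > 0\<close> \<open>e > 0\<close> by auto
  have "dist (f x) 0 < e" if x: "max S T \<le> x" for x
  proof (rule ccontr)
    assume "\<not> dist (f x) 0 < e"
    then have fx: "\<bar>f x\<bar> \<ge> e"
      by simp
    \<comment> \<open>From \<open>\<bar>f x\<bar> \<ge> e\<close> and increments below
      \<open>e / 2\<close>, \<open>\<bar>f\<bar>\<close> exceeds \<open>e / 2\<close> on the whole
      interval.\<close>
    have "integral {x..x + \<delta>} (\<lambda>_. (e / 2) powr r) \<le> integral {x..x + \<delta>} (\<lambda>x. \<bar>f x\<bar> powr r)"
    proof (rule integral_le)
      show "(\<lambda>x. \<bar>f x\<bar> powr r) integrable_on {x..x + \<delta>}"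
        using S(1) x by (intro integrable_on_subinterval[OF int]) auto
      show "(e / 2) powr r \<le> \<bar>f y\<bar> powr r" if "y \<in> {x..x + \<delta>}" for y
        using T[of x y] that x fx \<open>0 \<le> r\<close> \<open>e > 0\<close> by (intro powr_mono2) (auto simp: abs_if split: if_splits)
    qed auto
    then show False
      using S(2)[of x "x + \<delta>"] x \<open>\<delta> > 0\<close> by simp
  qed
  then show "\<forall>\<^sub>F x in at_top. dist (f x) 0 < e"
    using eventually_at_top_linorder by blast
qed

section \<open>Application to the mixed Sobolev space\<close>

theorem theorem5:
  fixes p q :: ennreal and f :: "real \<Rightarrow> real"
  assumes "1 \<le> p" and "p < \<infinity>"
    and "1 < q"
    and "f \<in> mixed_Sobolev p q"
  shows "(f \<longlongrightarrow> 0) at_top"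
proof -
  from assms(4) obtain g where fp: "Lp_fun (lebesgue_on {0<..}) p f"
    and ac: "locally_abs_continuous_on {0<..} f"
    and deriv: "AE x in lebesgue_on {0<..}. (f has_real_derivative g x) (at x)"
    and gq: "Lp_fun (lebesgue_on {0<..}) q g"
    by (auto simp: mixed_Sobolev_def)
  have fint: "(\<lambda>x. \<bar>f x\<bar> powr enn2real p) integrable_on {0<..}"
    using fp assms(2) by (auto simp: Lp_fun_def intro!: integrable_on_lebesgue_on)
  have AE_negligible: "\<exists>N. negligible N \<and> (\<forall>x>0. x \<notin> N \<longrightarrow> P x)"
    if "AE x in lebesgue_on {0<..}. P x" for P :: "real \<Rightarrow> bool"
    using that by (subst (asm) AE_restrict_space_iff) (auto simp: eventually_ae_filter_negligible)
  obtain N where N: "negligible N"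
    and derivN: "\<And>x. 0 < x \<Longrightarrow> x \<notin> N \<Longrightarrow> (f has_real_derivative g x) (at x)"
    using AE_negligible[OF deriv] by blast
  have fg: "(g has_integral (f y - f x)) {x..y}" if "0 < x" "x \<le> y" for x y
  proof (rule fundamental_theorem_of_calculus_abs_continuous[OF \<open>x \<le> y\<close> _ N])
    show "abs_continuous_on {x..y} f"
      using ac that by (simp add: locally_abs_continuous_on_def subset_iff)
    show "(f has_real_derivative g z) (at z within {x..y})" if "z \<in> {x..y} - N" for z
      using derivN[of z] that \<open>0 < x\<close> by (auto intro: has_field_derivative_at_within)
  qed
  \<comment> \<open>Infinite and finite \<open>q\<close> are brought to one form: a constant alone
    with \<open>h = 0\<close>, or the constant 1 with \<open>h\<close> the integrable power of
    \<open>\<bar>g\<bar>\<close>.\<close>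
  obtain N' C h where N': "negligible N'" and bound: "\<And>x. 0 < x \<Longrightarrow> x \<notin> N' \<Longrightarrow> \<bar>g x\<bar> \<le> C + h x"
    and h: "h integrable_on {0<..}" "\<And>x. 0 < x \<Longrightarrow> 0 \<le> h x" and C: "(0::real) \<le> C"
  proof (cases "q = \<infinity>")
    case True
    then obtain C where "AE x in lebesgue_on {0<..}. \<bar>g x\<bar> \<le> C"
      using gq by (auto simp: Lp_fun_def)
    then obtain M where "negligible M" "\<And>x. 0 < x \<Longrightarrow> x \<notin> M \<Longrightarrow> \<bar>g x\<bar> \<le> C"
      using AE_negligible by blast
    then show thesis
      \<comment> \<open>Passing to \<open>\<bar>C\<bar>\<close> makes nonnegativity of the essential
        bound immediate.\<close>
      by (intro that[of M "\<bar>C\<bar>" "\<lambda>_. 0"]) (fastforce intro: integrable_0)+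
  next
    case False
    define r where "r = enn2real q"
    have "r \<ge> 1"
      using assms(3) False unfolding r_def
      by (metis enn2real_1 enn2real_mono infinity_ennreal_def less_imp_le less_top)
    have "\<bar>g x\<bar> \<le> 1 + \<bar>g x\<bar> powr r" for x
    proof (cases "\<bar>g x\<bar> \<le> 1")
      case False
      then show ?thesis
        using powr_mono[OF \<open>r \<ge> 1\<close>, of "\<bar>g x\<bar>"] by simp
    qed (simp add: add_increasing2)
    moreover have "(\<lambda>x. \<bar>g x\<bar> powr r) integrable_on {0<..}"
      using gq False by (auto simp: Lp_fun_def r_def intro!: integrable_on_lebesgue_on)
    ultimately show thesis
      by (intro that[of "{}" 1 "\<lambda>x. \<bar>g x\<bar> powr r"]) auto
  qed
  show ?thesis
  proof (rule tendsto_0_at_top_if_increments_small[OF _ fint])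
    fix e :: real assume "e > 0"
    show "\<exists>T \<delta>. \<delta> > 0 \<and> (\<forall>x y. T \<le> x \<longrightarrow> x \<le> y \<longrightarrow> y \<le> x + \<delta> \<longrightarrow> \<bar>f y - f x\<bar> < e)"
      using increments_small_at_top[OF fg N' bound h C \<open>e > 0\<close>] by metis
  qed simp
qed

end
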